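(* In the worst case, $\Omega(\sigma\, z_{no}\log_\sigma n)$ substring queries are necessary to reconstruct a string of length $n$ over an alphabet of size $\sigma$: for any adaptive reconstruction algorithm there are strings $S$ of length $n$ on which it asks $\Omega(\sigma\, z_{no}(S)\log_\sigma n)$ substring queries.
   Context: A substring oracle knows the hidden string $S$ and answers queries of the form "Is $s$ a substring of $S$?" with yes/no; an adaptive reconstruction algorithm chooses queries depending on previous answers and must determine $S$ exactly. $z_{no}(S)$ is the number of phrases of the Lempel–Ziv 1977 factorization of $S$ without overlaps: $S$ is parsed left to right into phrases, where each new phrase is either a single character not occurring earlier in $S$, or the longest string starting at the current position that also occurs in $S$ at an earlier starting position with that earlier occurrence not overlapping the phrase itself.
   Formalization: The bound is stated with universal constants for 2 ≤ σ ≤ n and n large; without σ ≤ n it fails uniformly: for σ = n², O(n²) queries always suffice, while σ·z_no·log_σ n is at least (n² log₂ n)/2. *)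

theory Defs
  imports Complex_Main "HOL-Library.Sublist"
begin

text \<open>Strings are lists of natural numbers; an alphabet of size sigma is {..<sigma}.\<close>

definition lz_phrase_len :: "nat list \<Rightarrow> nat \<Rightarrow> nat" where
  "lz_phrase_len S i =
     (if S ! i \<notin> set (take i S) then 1
      else (GREATEST l. \<exists>j. j + l \<le> i \<and> i + l \<le> length S \<and>
                             take l (drop j S) = take l (drop i S)))"

fun lz_start :: "nat list \<Rightarrow> nat \<Rightarrow> nat" where
  "lz_start S 0 = 0"
| "lz_start S (Suc k) = lz_start S k + lz_phrase_len S (lz_start S k)"

definition z_no :: "nat list \<Rightarrow> nat" where
  "z_no S = (LEAST k. length S \<le> lz_start S k)"

text \<open>Adaptive reconstruction algorithms as (finite) decision trees:
  Ask s t_yes t_no asks "is s a substring of S?".\<close>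
datatype qtree = Answer "nat list" | Ask "nat list" qtree qtree

fun run :: "qtree \<Rightarrow> nat list \<Rightarrow> nat list" where
  "run (Answer r) S = r"
| "run (Ask s ty tn) S = (if sublist s S then run ty S else run tn S)"

fun num_queries :: "qtree \<Rightarrow> nat list \<Rightarrow> nat" where
  "num_queries (Answer r) S = 0"
| "num_queries (Ask s ty tn) S = Suc (if sublist s S then num_queries ty S else num_queries tn S)"

end

theory Submission
  imports Defs "HOL-Library.FuncSet"
begin

text \<open>
  Consider strings D c(0) w(0) c(1) w(1) ... c(m-1) w(m-1), where the words w(i) are free words of
  length L over an alphabet Y, the anchors c(i) are fixed, and D contains every word over Y
  together with every piece of anchor that could surround it. If each anchor has only one possible
  position, then a query either contains an anchor, and hence fits at one position only and asks
  for a conjunction of equations "this letter of this word is a", or has an answer independent of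
  the words. An adversary that says no whenever possible loses one candidate for one letter per
  query, so m L (|Y| - 1) queries are needed, while the Lempel-Ziv parse has O(m) phrases as soon
  as D has that many, each w(i) being copied from D.

  For sigma at least 4 and sigma^5 at most n, runs of zeros between separators serve as anchors,
  with L proportional to log n / log sigma and m = L |Y|^L, which pays for the dictionary D. For
  larger sigma the logarithm is bounded, and L = 1 with single letters as anchors suffices. For
  sigma in {2, 3} counting the binary words is enough.
\<close>

definition words :: "'a set \<Rightarrow> nat \<Rightarrow> 'a list set" where
  "words A n = {w. set w \<subseteq> A \<and> length w = n}"

lemma words_mono: "A \<subseteq> B \<Longrightarrow> words A n \<subseteq> words B n"
  by (auto simp: words_def)

lemma set_n_lists_eq_words: "set (List.n_lists n xs) = words (set xs) n"
  by (auto simp: set_n_lists words_def)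

lemma sublist_replicate: "k \<le> n \<Longrightarrow> sublist (replicate k a) (replicate n a)"
  by (metis le_add_diff_inverse replicate_add sublist_append_rightI)

lemma sublist_concat_map: "x \<in> set xs \<Longrightarrow> sublist (g x) (concat (map g xs))"
  by (metis concat.simps(2) concat_append list.simps(9) map_append split_list sublist_appendI)

lemma length_concat_n_lists: "length (concat (List.n_lists n xs)) = n * length xs ^ n"
proof -
  have "length (concat (List.n_lists n xs)) = (\<Sum>w\<leftarrow>List.n_lists n xs. n)"
    unfolding length_concat
    by (intro arg_cong[where f = sum_list] map_cong) (auto simp: set_n_lists_eq_words words_def)
  then show ?thesis by (simp add: sum_list_triv length_n_lists)
qed

definition reconstructs :: "qtree \<Rightarrow> nat list set \<Rightarrow> bool" where
  "reconstructs T W \<longleftrightarrow> (\<forall>S\<in>W. run T S = S)"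

lemma reconstructs_subset: "reconstructs T W \<Longrightarrow> V \<subseteq> W \<Longrightarrow> reconstructs T V"
  by (auto simp: reconstructs_def)

lemma reconstructs_Ask_yes:
  "reconstructs (Ask s ty tn) W \<Longrightarrow> (\<And>S. S \<in> W \<Longrightarrow> sublist s S) \<Longrightarrow> reconstructs ty W"
  by (simp add: reconstructs_def)

lemma reconstructs_Ask_no:
  "reconstructs (Ask s ty tn) W \<Longrightarrow> (\<And>S. S \<in> W \<Longrightarrow> \<not> sublist s S) \<Longrightarrow> reconstructs tn W"
  by (simp add: reconstructs_def)

subsection \<open>Parsings into letters and copies\<close>

inductive lz_parsing :: "nat list \<Rightarrow> nat \<Rightarrow> bool" where
  empty: "lz_parsing [] 0"
| letter: "lz_parsing P k \<Longrightarrow> lz_parsing (P @ [a]) (Suc k)"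
| copy: "lz_parsing P k \<Longrightarrow> sublist u P \<Longrightarrow> lz_parsing (P @ u) (Suc k)"

lemma lz_phrase_len_ge:
  assumes i: "i < length S" and l: "0 < l" "i + l \<le> length S"
    and j: "j + l \<le> i" and eq: "take l (drop j S) = take l (drop i S)"
  shows "l \<le> lz_phrase_len S i"
proof -
  have "S ! i = take l (drop i S) ! 0" using i l by simp
  also have "\<dots> = S ! j" using j i l by (simp flip: eq)
  finally have "S ! i = take i S ! j" using j l by simp
  moreover have "take i S ! j \<in> set (take i S)" using j l i by (intro nth_mem) simp
  ultimately have not_new: "S ! i \<in> set (take i S)" by simp
  have "l \<le> (GREATEST l. \<exists>j. j + l \<le> i \<and> i + l \<le> length S \<and>
                             take l (drop j S) = take l (drop i S))"
    by (rule Greatest_le_nat[where b = i]) (use l j eq in auto)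
  then show ?thesis using not_new by (simp add: lz_phrase_len_def)
qed

lemma lz_phrase_len_pos:
  assumes i: "i < length S"
  shows "1 \<le> lz_phrase_len S i"
proof (cases "S ! i \<in> set (take i S)")
  case False
  then show ?thesis by (simp add: lz_phrase_len_def)
next
  case True
  then obtain j where j: "j < i" "S ! j = S ! i" using i by (auto simp: in_set_conv_nth)
  have "take 1 (drop j S) = take 1 (drop i S)"
    using i j by (simp add: take_Suc_conv_app_nth)
  then show ?thesis using i j by (intro lz_phrase_len_ge[of i S 1 j]) auto
qed

lemma lz_phrase_len_inside_copy_ge:
  assumes "sublist u P" and d: "d < length u"
  shows "length u - d \<le> lz_phrase_len (P @ u @ Q) (length P + d)"
proof -
  let ?S = "P @ u @ Q"
  obtain X Y where P: "P = X @ u @ Y" using assms(1) by (auto simp: sublist_def)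
  show ?thesis
  proof (rule lz_phrase_len_ge[where j = "length X + d"])
    have "take (length u - d) (drop (length X + d) ?S) = drop d u" using d by (simp add: P)
    also have "\<dots> = take (length u - d) (drop (length P + d) ?S)" using d by simp
    finally show "take (length u - d) (drop (length X + d) ?S) =
      take (length u - d) (drop (length P + d) ?S)" .
  qed (use d P in auto)
qed

lemma lz_start_greedy:
  assumes "lz_parsing P k"
  shows "length P \<le> lz_start (P @ Q) k"
  using assms
proof (induction arbitrary: Q rule: lz_parsing.induct)
  case empty
  then show ?case by simp
next
  case (letter P k a)
  let ?S = "P @ a # Q"
  let ?p = "lz_start ?S k"
  have "length P \<le> ?p" by (rule letter.IH)
  moreover have "1 \<le> lz_phrase_len ?S ?p" if "?p = length P"
    by (rule lz_phrase_len_pos) (simp add: that)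
  ultimately show ?case by (cases "?p = length P") auto
next
  case (copy P k u)
  let ?S = "P @ u @ Q"
  let ?p = "lz_start ?S k"
  have p: "length P \<le> ?p" by (rule copy.IH)
  have "length u - (?p - length P) \<le> lz_phrase_len ?S ?p" if "?p < length (P @ u)"
    using lz_phrase_len_inside_copy_ge[OF copy.hyps(2), of "?p - length P" Q] that p by simp
  then show ?case using p by (cases "?p < length (P @ u)") auto
qed

lemma z_no_le_lz_parsing: "lz_parsing S k \<Longrightarrow> z_no S \<le> k"
  unfolding z_no_def using lz_start_greedy[of S k "[]"] by (intro Least_le) simp

lemma lz_parsing_mono:
  assumes "lz_parsing P k" "k \<le> k'"
  shows "lz_parsing P k'"
  using assms(2) by (induction rule: dec_induct)
    (use assms(1) lz_parsing.copy[of P _ "[]"] in auto)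

definition lz_append :: "nat list \<Rightarrow> nat list \<Rightarrow> nat \<Rightarrow> bool" where
  "lz_append D u t \<longleftrightarrow> (\<forall>P k. sublist D P \<longrightarrow> lz_parsing P k \<longrightarrow> lz_parsing (P @ u) (k + t))"

lemma lz_parsing_append: "lz_parsing D k \<Longrightarrow> lz_append D u t \<Longrightarrow> lz_parsing (D @ u) (k + t)"
  by (simp add: lz_append_def)

lemma lz_parsing_if_append_Nil: "lz_append [] u t \<Longrightarrow> lz_parsing u t"
  using lz_parsing_append[OF lz_parsing.empty] by simp

lemma lz_append_sublist: "sublist u D \<Longrightarrow> lz_append D u 1"
  by (auto simp: lz_append_def intro: lz_parsing.copy sublist_order.order.trans)

lemma lz_append_append:
  assumes "lz_append D u s" "lz_append D v t"
  shows "lz_append D (u @ v) (s + t)"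
  unfolding lz_append_def
proof (intro allI impI)
  fix P k assume P: "sublist D P" "lz_parsing P k"
  then have "lz_parsing (P @ u) (k + s)" using assms(1) by (simp add: lz_append_def)
  moreover have "sublist D (P @ u)"
    using P(1) sublist_append_rightI sublist_order.order.trans by blast
  ultimately have "lz_parsing ((P @ u) @ v) (k + s + t)"
    using assms(2) unfolding lz_append_def by blast
  then show "lz_parsing (P @ u @ v) (k + (s + t))" by (simp add: add.assoc)
qed

lemma lz_append_letters: "lz_append D u (length u)"
proof (induction u)
  case Nil
  then show ?case by (simp add: lz_append_def)
next
  case (Cons a u)
  have "lz_append D [a] 1" by (simp add: lz_append_def lz_parsing.letter)
  from lz_append_append[OF this Cons.IH] show ?case by simp
qed

lemma lz_append_concat_map:
  assumes "\<And>x. x \<in> set xs \<Longrightarrow> lz_append D (g x) t"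
  shows "lz_append D (concat (map g xs)) (length xs * t)"
  using assms
proof (induction xs)
  case Nil
  then show ?case using lz_append_letters[of D "[]"] by simp
next
  case (Cons x xs)
  then show ?case using lz_append_append[of D "g x" t "concat (map g xs)" "length xs * t"] by simp
qed

lemma lz_append_mono: "lz_append D u s \<Longrightarrow> s \<le> t \<Longrightarrow> lz_append D u t"
  unfolding lz_append_def by (meson add_left_mono lz_parsing_mono)

lemma lz_append_replicate: "R \<le> 2 ^ k \<Longrightarrow> lz_append D (replicate R a) (Suc k)"
proof (induction k arbitrary: R)
  case 0
  then show ?case using lz_append_mono[OF lz_append_letters, of "replicate R a" 1] by simp
next
  case (Suc k)
  show ?case
  proof (cases "R \<le> 2 ^ k")
    case True
    from lz_append_mono[OF Suc.IH[OF this]] show ?thesis by simp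
  next
    case False
    define r where "r = R - 2 ^ k"
    have r: "R = 2 ^ k + r" "r \<le> 2 ^ k" using False Suc.prems by (auto simp: r_def)
    show ?thesis
      unfolding lz_append_def
    proof (intro allI impI)
      fix P k' assume "sublist D P" "lz_parsing P k'"
      then have "lz_parsing (P @ replicate (2 ^ k) a) (k' + Suc k)"
        using Suc.IH[OF order_refl] by (simp add: lz_append_def)
      moreover have "sublist (replicate r a) (P @ replicate (2 ^ k) a)"
        using sublist_replicate[OF r(2)] by (rule sublist_order.order.trans) simp
      ultimately have "lz_parsing ((P @ replicate (2 ^ k) a) @ replicate r a) (Suc (k' + Suc k))"
        by (rule lz_parsing.copy)
      then show "lz_parsing (P @ replicate R a) (k' + Suc (Suc k))"
        by (simp add: r(1) replicate_add)
    qed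
  qed
qed

subsection \<open>Lower bounds for decision trees\<close>

text \<open>Because of \<open>A i = {}\<close> a predicate that never holds is conjunctive as well.\<close>

definition conjunctive_on :: "'i set \<Rightarrow> 'a set \<Rightarrow> (('i \<Rightarrow> 'a) \<Rightarrow> bool) \<Rightarrow> bool" where
  "conjunctive_on I Y P \<longleftrightarrow> (\<exists>A. (\<forall>i\<in>I. Y \<subseteq> A i \<or> (\<exists>a. A i \<subseteq> {a})) \<and>
     (\<forall>f\<in>I \<rightarrow> Y. P f \<longleftrightarrow> f \<in> Pi I A))"

lemma conjunctive_on_const:
  assumes "I \<noteq> {}" "\<And>f. f \<in> I \<rightarrow> Y \<Longrightarrow> P f = b"
  shows "conjunctive_on I Y P"
  unfolding conjunctive_on_def
proof (intro exI[of _ "\<lambda>_. if b then Y else {}"] conjI ballI)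
  show "P f \<longleftrightarrow> f \<in> Pi I (\<lambda>_. if b then Y else {})" if "f \<in> I \<rightarrow> Y" for f
    using assms that by (cases b) auto
qed auto

lemma conjunctive_on_equations:
  assumes "K \<subseteq> I" "\<And>f. f \<in> I \<rightarrow> Y \<Longrightarrow> P f \<longleftrightarrow> (\<forall>k\<in>K. f k = a k)"
  shows "conjunctive_on I Y P"
  unfolding conjunctive_on_def
proof (intro exI[of _ "\<lambda>k. if k \<in> K then {a k} else UNIV"] conjI ballI)
  show "P f \<longleftrightarrow> f \<in> Pi I (\<lambda>k. if k \<in> K then {a k} else UNIV)" if "f \<in> I \<rightarrow> Y" for f
    using assms that by (auto simp: Pi_def)
qed auto

lemma sum_card_eq_0_if_singletons:
  assumes "\<And>i. i \<in> I \<Longrightarrow> C i \<noteq> {}"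
    and const: "\<And>f f' i. f \<in> Pi I C \<Longrightarrow> f' \<in> Pi I C \<Longrightarrow> i \<in> I \<Longrightarrow> f i = f' i"
  shows "(\<Sum>i\<in>I. card (C i) - 1) = 0"
proof -
  have "Pi I C \<noteq> {}" using assms(1) by simp
  then obtain f where f: "f \<in> Pi I C" by blast
  have "C i = {f i}" if i: "i \<in> I" for i
  proof -
    have "y = f i" if y: "y \<in> C i" for y
    proof -
      have "f(i := y) \<in> Pi I C" using f y by (simp add: Pi_def)
      from const[OF this f i] show ?thesis by simp
    qed
    then show ?thesis using f i by auto
  qed
  then show ?thesis by simp
qed

lemma sum_card_fun_upd_le:
  assumes "finite I" "k \<in> I" "C k \<subseteq> insert a B" "B \<noteq> {}" "finite B"
  shows "(\<Sum>i\<in>I. card (C i) - 1) \<le> Suc (\<Sum>i\<in>I. card ((C(k := B)) i) - 1)"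
proof -
  have "card (C k) \<le> card (insert a B)" using assms(3,5) by (intro card_mono) auto
  also have "\<dots> \<le> Suc (card B)" using assms(5) by (simp add: card_insert_if)
  finally have "card (C k) \<le> Suc (card B)" .
  moreover have "0 < card B" using assms(4,5) by (simp add: card_gt_0_iff)
  ultimately have "card (C k) - 1 \<le> Suc (card B - 1)" by simp
  moreover have "(\<Sum>i\<in>I - {k}. card ((C(k := B)) i) - 1) = (\<Sum>i\<in>I - {k}. card (C i) - 1)"
    by (rule sum.cong) auto
  ultimately show ?thesis by (simp add: sum.remove[OF assms(1,2)])
qed

lemma conjunctive_on_answer_cases:
  assumes "finite I" "finite Y" and conj: "conjunctive_on I Y P"
    and C: "\<forall>i\<in>I. C i \<subseteq> Y"
  obtains (yes) "\<And>f. f \<in> Pi I C \<Longrightarrow> P f"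
    | (no) C' where "\<And>i. i \<in> I \<Longrightarrow> C' i \<subseteq> C i"
        "\<And>i. i \<in> I \<Longrightarrow> C i \<noteq> {} \<Longrightarrow> C' i \<noteq> {}"
        "\<And>f. f \<in> Pi I C' \<Longrightarrow> \<not> P f"
        "(\<Sum>i\<in>I. card (C i) - 1) \<le> Suc (\<Sum>i\<in>I. card (C' i) - 1)"
proof -
  obtain A where A: "\<forall>i\<in>I. Y \<subseteq> A i \<or> (\<exists>a. A i \<subseteq> {a})"
    and iff: "\<forall>f\<in>I \<rightarrow> Y. P f \<longleftrightarrow> f \<in> Pi I A"
    using conj unfolding conjunctive_on_def by (elim exE conjE) (rule that)
  have C_Y: "Pi I C \<subseteq> I \<rightarrow> Y" using C by (intro Pi_mono) simp
  show thesis
  proof (cases "\<forall>i\<in>I. C i \<subseteq> A i")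
    case True
    then have "Pi I C \<subseteq> Pi I A" by (intro Pi_mono) auto
    then show thesis using yes iff C_Y by (metis subsetD)
  next
    case False
    then obtain k where k: "k \<in> I" "\<not> C k \<subseteq> A k" by blast
    then obtain a where a: "A k \<subseteq> {a}" using A C by blast
    define B where "B = C k - A k"
    have "finite (C k)" using C k(1) \<open>finite Y\<close> finite_subset by blast
    then have B: "B \<noteq> {}" "finite B" using k(2) by (auto simp: B_def)
    show thesis
    proof (rule no[of "C(k := B)"])
      show sub: "(C(k := B)) i \<subseteq> C i" for i by (simp add: B_def)
      show "(C(k := B)) i \<noteq> {}" if "C i \<noteq> {}" for i using that B(1) by simp
      show "\<not> P f" if f: "f \<in> Pi I (C(k := B))" for f
      proof -
        have "f k \<in> (C(k := B)) k" using f k(1) by (rule Pi_mem)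
        then have "f \<notin> Pi I A" using k(1) by (auto simp: B_def)
        moreover have "f \<in> Pi I C" using f Pi_mono[OF sub] by (rule rev_subsetD)
        ultimately show ?thesis using iff C_Y by (metis subsetD)
      qed
      have "C k \<subseteq> insert a B" using a by (auto simp: B_def)
      then show "(\<Sum>i\<in>I. card (C i) - 1) \<le> Suc (\<Sum>i\<in>I. card ((C(k := B)) i) - 1)"
        using \<open>finite I\<close> k(1) B by (intro sum_card_fun_upd_le)
    qed
  qed
qed

lemma adversary_num_queries:
  fixes G :: "('i \<Rightarrow> 'a) \<Rightarrow> nat list"
  assumes "finite I" "finite Y"
    and inj: "\<And>f f'. G f = G f' \<Longrightarrow> \<forall>i\<in>I. f i = f' i"
    and queries: "\<And>s. conjunctive_on I Y (\<lambda>f. sublist s (G f))"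
    and "\<And>i. i \<in> I \<Longrightarrow> C i \<subseteq> Y \<and> C i \<noteq> {}"
    and "reconstructs T (G ` Pi I C)"
  shows "\<exists>f\<in>Pi I C. (\<Sum>i\<in>I. card (C i) - 1) \<le> num_queries T (G f)"
  using assms(5,6)
proof (induction T arbitrary: C)
  case (Answer r)
  have "f i = f' i" if "f \<in> Pi I C" "f' \<in> Pi I C" "i \<in> I" for f f' i
    using Answer.prems(2) inj that by (simp add: reconstructs_def) metis
  then have "(\<Sum>i\<in>I. card (C i) - 1) = 0"
    using Answer.prems(1) by (intro sum_card_eq_0_if_singletons) auto
  moreover have "Pi I C \<noteq> {}" using Answer.prems(1) by simp
  then obtain f where "f \<in> Pi I C" by blast
  ultimately show ?case by (intro bexI[of _ f]) simp_all
next
  case (Ask s ty tn)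
  have "\<forall>i\<in>I. C i \<subseteq> Y" using Ask.prems(1) by blast
  with \<open>finite I\<close> \<open>finite Y\<close> queries[of s] show ?case
  proof (cases rule: conjunctive_on_answer_cases)
    case yes
    then have "reconstructs ty (G ` Pi I C)"
      using Ask.prems(2) by (auto intro: reconstructs_Ask_yes)
    then obtain f where "f \<in> Pi I C" "(\<Sum>i\<in>I. card (C i) - 1) \<le> num_queries ty (G f)"
      using Ask.IH(1) Ask.prems(1) by blast
    then show ?thesis using yes by (auto intro: le_SucI)
  next
    case (no C')
    have sub: "Pi I C' \<subseteq> Pi I C" using no(1) by (rule Pi_mono)
    have "reconstructs (Ask s ty tn) (G ` Pi I C')"
      using Ask.prems(2) image_mono[OF sub] by (rule reconstructs_subset)
    then have "reconstructs tn (G ` Pi I C')" using no(3) by (auto intro: reconstructs_Ask_no)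
    moreover have "C' i \<subseteq> Y \<and> C' i \<noteq> {}" if "i \<in> I" for i
      using no(1,2)[OF that] Ask.prems(1)[OF that] by blast
    ultimately obtain f
      where f: "f \<in> Pi I C'" "(\<Sum>i\<in>I. card (C' i) - 1) \<le> num_queries tn (G f)"
      using Ask.IH(2)[of C'] by blast
    then show ?thesis using no(3,4) sub by (intro bexI[of _ f]) auto
  qed
qed

lemma card_le_two_power_num_queries:
  assumes "reconstructs T F" "\<And>S. S \<in> F \<Longrightarrow> num_queries T S \<le> d"
  shows "finite F \<and> card F \<le> 2 ^ d"
  using assms
proof (induction T arbitrary: F d)
  case (Answer r)
  then have F: "F \<subseteq> {r}" by (auto simp: reconstructs_def)
  then have "finite F" "card F \<le> 1" using finite_subset card_mono[OF _ F] by auto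
  then show ?case by (meson one_le_numeral one_le_power order.trans)
next
  case (Ask s ty tn)
  show ?case
  proof (cases d)
    case 0
    then have "F = {}" using Ask.prems(2) by fastforce
    then show ?thesis by simp
  next
    case (Suc d')
    let ?Y = "{S \<in> F. sublist s S}" and ?N = "{S \<in> F. \<not> sublist s S}"
    have Y: "finite ?Y \<and> card ?Y \<le> 2 ^ d'"
      using Ask.prems Suc by (intro Ask.IH(1)) (force simp: reconstructs_def)+
    have N: "finite ?N \<and> card ?N \<le> 2 ^ d'"
      using Ask.prems Suc by (intro Ask.IH(2)) (force simp: reconstructs_def)+
    have F: "F = ?Y \<union> ?N" by blast
    have "card F \<le> card ?Y + card ?N" by (subst F) (rule card_Un_le)
    moreover have "finite F" by (subst F) (use Y N in simp)
    ultimately show ?thesis using Y N Suc by simp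
  qed
qed

lemma counting_num_queries:
  fixes G :: "('i \<Rightarrow> 'a) \<Rightarrow> nat list"
  assumes "finite I" "2 \<le> card Y"
    and inj: "\<And>f f'. G f = G f' \<Longrightarrow> \<forall>i\<in>I. f i = f' i"
    and T: "reconstructs T (G ` (I \<rightarrow> Y))"
  shows "\<exists>f\<in>I \<rightarrow> Y. card I \<le> num_queries T (G f)"
proof (rule ccontr)
  let ?F = "I \<rightarrow>\<^sub>E Y"
  assume "\<not> ?thesis"
  then have few: "num_queries T (G f) < card I" if "f \<in> I \<rightarrow> Y" for f using that by force
  have "Y \<noteq> {}" using assms(2) by auto
  then obtain f where "f \<in> I \<rightarrow> Y" by fast
  then have pos: "0 < card I" using few by fastforce
  have F_sub: "?F \<subseteq> (I \<rightarrow> Y)" by (auto simp: PiE_def)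
  have "card (G ` ?F) \<le> 2 ^ (card I - 1)"
  proof (rule card_le_two_power_num_queries[THEN conjunct2])
    show "reconstructs T (G ` ?F)" using T image_mono[OF F_sub] by (rule reconstructs_subset)
    show "num_queries T S \<le> card I - 1" if "S \<in> G ` ?F" for S
      using that few F_sub by fastforce
  qed
  moreover have "inj_on G ?F"
  proof (rule inj_onI)
    show "f = f'" if "f \<in> ?F" "f' \<in> ?F" "G f = G f'" for f f'
      using inj[OF that(3)] by (intro PiE_ext[OF that(1,2)]) simp
  qed
  then have "card (G ` ?F) = card Y ^ card I"
    using \<open>finite I\<close> by (simp add: card_image card_funcsetE)
  moreover have "2 ^ card I \<le> card Y ^ card I" using assms(2) by (rule power_mono) simp
  ultimately have "(2::nat) ^ card I \<le> 2 ^ (card I - 1)" by linarith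
  then have "card I \<le> card I - 1" by (rule power_le_imp_le_exp[rotated]) simp
  then show False using pos by linarith
qed

subsection \<open>Templates\<close>

definition at_most_once :: "'a list \<Rightarrow> 'a list \<Rightarrow> bool" where
  "at_most_once u t \<longleftrightarrow> (\<forall>X Z X' Z'. t = X @ u @ Z \<longrightarrow> t = X' @ u @ Z' \<longrightarrow> X = X')"

lemma at_most_once_singleton:
  assumes "v \<notin> set A" "v \<notin> set B"
  shows "at_most_once [v] (A @ v # B)"
  using assms by (auto simp: at_most_once_def append_Cons_eq_iff)

lemma at_most_once_concat_map:
  assumes "distinct xs" "x \<in> set xs" "inj_on a (set xs)"
    and "a x \<notin> set P" "\<And>y. y \<in> set xs \<Longrightarrow> a x \<notin> set (r y)"
  shows "at_most_once [a x] (P @ concat (map (\<lambda>y. a y # r y) xs))"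
proof -
  obtain ys zs where xs: "xs = ys @ x # zs" using assms(2) by (meson split_list)
  let ?g = "\<lambda>y. a y # r y"
  have neq: "a x \<noteq> a y" if "y \<in> set ys \<union> set zs" for y
    using assms(1,3) that by (auto simp: xs inj_on_def)
  have "P @ concat (map ?g xs) = (P @ concat (map ?g ys)) @ a x # r x @ concat (map ?g zs)"
    by (simp add: xs)
  moreover have "a x \<notin> set (P @ concat (map ?g ys))" "a x \<notin> set (r x @ concat (map ?g zs))"
    using assms(4,5) neq by (auto simp: xs)
  ultimately show ?thesis using at_most_once_singleton by metis
qed

type_synonym 'i template = "(nat + 'i) list"

definition fill :: "'i template \<Rightarrow> ('i \<Rightarrow> nat) \<Rightarrow> nat list" where
  "fill t f = map (case_sum id f) t"

definition holes :: "'i template \<Rightarrow> 'i set" where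
  "holes t = {k. Inr k \<in> set t}"

lemma length_fill [simp]: "length (fill t f) = length t"
  by (simp add: fill_def)

lemma fill_eq_iff: "fill t f = fill t f' \<longleftrightarrow> (\<forall>k\<in>holes t. f k = f' k)"
  by (auto simp: fill_def holes_def split: sum.splits)

lemma set_fill_subset: "f \<in> holes t \<rightarrow> Y \<Longrightarrow> set (fill t f) \<subseteq> {a. Inl a \<in> set t} \<union> Y"
  by (auto simp: fill_def holes_def split: sum.splits)

lemma fill_eq_appendD:
  assumes "f \<in> holes t \<rightarrow> Y" "set u \<inter> Y = {}" "fill t f = X @ u @ Z"
  obtains X' Z' where "t = X' @ map Inl u @ Z'" "length X' = length X"
proof -
  obtain X' u' Z' where t: "t = X' @ u' @ Z'" and u': "fill u' f = u" and X: "fill X' f = X"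
    using assms(3) by (auto simp: fill_def map_eq_append_conv append_eq_map_conv)
  have "e = Inl (case_sum id f e)" if e: "e \<in> set u'" for e
  proof (cases e)
    case (Inr k)
    then have "f k \<in> set u" using e u' by (force simp: fill_def)
    moreover have "f k \<in> Y" using assms(1) e Inr by (auto simp: t holes_def)
    ultimately show ?thesis using assms(2) by blast
  qed simp
  then have "u' = map (\<lambda>e. Inl (case_sum id f e)) u'" by (simp add: map_idI)
  also have "\<dots> = map Inl u" by (simp add: fill_def flip: u')
  finally have "t = X' @ map Inl u @ Z'" by (simp add: t)
  moreover have "length X' = length X" by (simp flip: X)
  ultimately show thesis by (rule that)
qed

lemma length_prefix_eq_if_at_most_once:
  assumes once: "at_most_once (map Inl u) t" and u: "set u \<inter> Y = {}"
    and f: "f \<in> holes t \<rightarrow> Y" "fill t f = X @ u @ Z"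
    and f': "f' \<in> holes t \<rightarrow> Y" "fill t f' = X' @ u @ Z'"
  shows "length X = length X'"
proof -
  obtain V W where V: "t = V @ map Inl u @ W" "length V = length X"
    using fill_eq_appendD[OF f(1) u f(2)] .
  obtain V' W' where V': "t = V' @ map Inl u @ W'" "length V' = length X'"
    using fill_eq_appendD[OF f'(1) u f'(2)] .
  have "V = V'" using once V(1) V'(1) unfolding at_most_once_def by blast
  then show ?thesis using V(2) V'(2) by simp
qed

lemma conjunctive_on_sublist_fill:
  assumes once: "at_most_once (map Inl u) t" and u: "set u \<inter> Y = {}" "sublist u s"
    and "holes t \<noteq> {}"
  shows "conjunctive_on (holes t) Y (\<lambda>f. sublist s (fill t f))"
proof (cases "\<exists>f\<in>holes t \<rightarrow> Y. sublist s (fill t f)")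
  case False
  then show ?thesis using assms(4) by (intro conjunctive_on_const[where b = False]) auto
next
  case True
  then obtain f0 X Z where f0: "f0 \<in> holes t \<rightarrow> Y" "fill t f0 = X @ s @ Z"
    by (auto simp: sublist_def)
  obtain A B where s: "s = A @ u @ B" using u(2) by (auto simp: sublist_def)
  define v where "v = take (length s) (drop (length X) t)"
  have fill_v: "fill v f = take (length s) (drop (length X) (fill t f))" for f
    by (simp add: v_def fill_def take_map drop_map)
  have "sublist s (fill t f) \<longleftrightarrow> (\<forall>k\<in>holes v. f k = f0 k)" if f: "f \<in> holes t \<rightarrow> Y" for f
  proof
    assume "sublist s (fill t f)"
    then obtain X' Z' where X': "fill t f = X' @ s @ Z'" by (auto simp: sublist_def)
    have "length (X @ A) = length (X' @ A)"
      by (rule length_prefix_eq_if_at_most_once[OF once u(1) f0(1) _ f, of _ "B @ Z" _ "B @ Z'"])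
        (simp_all add: f0(2) X' s)
    then have "fill v f = fill v f0" by (simp add: fill_v X' f0(2))
    then show "\<forall>k\<in>holes v. f k = f0 k" by (simp add: fill_eq_iff)
  next
    assume "\<forall>k\<in>holes v. f k = f0 k"
    then have "s = take (length s) (drop (length X) (fill t f))"
      using f0(2) fill_v[of f] fill_v[of f0] by (simp add: fill_eq_iff[symmetric])
    then show "sublist s (fill t f)"
      by (metis sublist_drop sublist_order.order.trans sublist_take)
  qed
  moreover have "holes v \<subseteq> holes t"
    by (auto simp: v_def holes_def dest: in_set_takeD in_set_dropD)
  ultimately show ?thesis by (intro conjunctive_on_equations)
qed

definition slots :: "nat list \<Rightarrow> (nat \<Rightarrow> nat list) \<Rightarrow> nat \<Rightarrow> nat \<Rightarrow> (nat \<times> nat) template" where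
  "slots D c L m =
     map Inl D @ concat (map (\<lambda>i. map Inl (c i) @ map (\<lambda>j. Inr (i, j)) [0..<L]) [0..<m])"

definition slot_word :: "(nat \<times> nat \<Rightarrow> nat) \<Rightarrow> nat \<Rightarrow> nat \<Rightarrow> nat list" where
  "slot_word f L i = map (\<lambda>j. f (i, j)) [0..<L]"

lemma fill_slots: "fill (slots D c L m) f = D @ concat (map (\<lambda>i. c i @ slot_word f L i) [0..<m])"
  by (simp add: fill_def slots_def slot_word_def map_concat comp_def)

lemma holes_slots: "holes (slots D c L m) = {..<m} \<times> {..<L}"
  by (auto simp: holes_def slots_def image_iff)

lemma length_slots: "length (slots D c L m) = length D + (\<Sum>i<m. length (c i) + L)"
  by (simp add: slots_def length_concat comp_def interv_sum_list_conv_sum_set_nat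
      atLeast0LessThan)

lemma slot_word_in_words:
  assumes "f \<in> holes (slots D c L m) \<rightarrow> Y" "i < m"
  shows "slot_word f L i \<in> words Y L"
  using assms by (auto simp: holes_slots slot_word_def words_def)

lemma fill_slots_in_words:
  assumes "f \<in> holes (slots D c L m) \<rightarrow> Y" "length (slots D c L m) = n"
    and "set D \<union> (\<Union>i<m. set (c i)) \<union> Y \<subseteq> A"
  shows "fill (slots D c L m) f \<in> words A n"
proof -
  have "{a. Inl a \<in> set (slots D c L m)} \<subseteq> set D \<union> (\<Union>i<m. set (c i))"
    by (auto simp: slots_def)
  then have "set (fill (slots D c L m) f) \<subseteq> A"
    using set_fill_subset[OF assms(1)] assms(3) by blast
  then show ?thesis using assms(2) by (simp add: words_def)
qed

lemma z_no_fill_slots_le: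
  assumes "lz_parsing D k" "\<And>i. i < m \<Longrightarrow> lz_append D (c i) t"
    and dict: "\<And>w. w \<in> words Y L \<Longrightarrow> sublist w D"
    and f: "f \<in> holes (slots D c L m) \<rightarrow> Y"
  shows "z_no (fill (slots D c L m) f) \<le> k + m * (t + 1)"
proof (rule z_no_le_lz_parsing)
  have "lz_append D (c i @ slot_word f L i) (t + 1)" if "i < m" for i
    using assms(2) dict slot_word_in_words[OF f] that
    by (intro lz_append_append lz_append_sublist) auto
  then have "lz_append D (concat (map (\<lambda>i. c i @ slot_word f L i) [0..<m]))
      (length [0..<m] * (t + 1))"
    by (intro lz_append_concat_map) simp
  then show "lz_parsing (fill (slots D c L m) f) (k + m * (t + 1))"
    using lz_parsing_append[OF assms(1)] by (simp add: fill_slots)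
qed

subsection \<open>Anchored slots\<close>

lemma sublist_append_avoiding:
  assumes "sublist s (X @ u @ Z)" "\<not> sublist u s" "u \<noteq> []"
  shows "sublist s (X @ butlast u) \<or> sublist s (tl u @ Z)"
proof -
  obtain A B where eq: "X @ u @ Z = A @ s @ B" using assms(1) by (auto simp: sublist_def)
  consider (starts_after) "length A > length X"
    | (ends_before) "length A + length s < length (X @ u)"
    | (covers) "length A \<le> length X" "length (X @ u) \<le> length A + length s" by linarith
  then show ?thesis
  proof cases
    case starts_after
    have "tl u @ Z = drop (Suc (length X)) (X @ u @ Z)" using assms(3) by (cases u) auto
    also have "\<dots> = drop (Suc (length X)) A @ s @ B" using starts_after by (simp add: eq)
    finally show ?thesis by (metis sublist_appendI)
  next
    case ends_before
    have "X @ butlast u = take (length (X @ u) - 1) (X @ u @ Z)"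
      using assms(3) by (cases u rule: rev_cases) simp_all
    also have "\<dots> = A @ s @ take (length (X @ u) - 1 - length A - length s) B"
      using ends_before by (simp add: eq)
    finally show ?thesis by (metis sublist_appendI)
  next
    case covers
    have "u = take (length u) (drop (length X - length A) (drop (length A) (X @ u @ Z)))"
      using covers by simp
    also have "\<dots> = take (length u) (drop (length X - length A) s)"
      using covers by (simp add: eq)
    finally have "sublist u s" by (metis sublist_drop sublist_order.order.trans sublist_take)
    then show ?thesis using assms(2) by simp
  qed
qed

locale anchored_slots =
  fixes D :: "nat list" and c :: "nat \<Rightarrow> nat list" and L m :: nat and Y :: "nat set"
  assumes finite_Y: "finite Y" and Y_nonempty: "Y \<noteq> {}"
    and L_pos: "0 < L" and m_pos: "0 < m"
    and anchor_nonempty: "i < m \<Longrightarrow> c i \<noteq> []"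
    and anchor_disjoint: "i < m \<Longrightarrow> set (c i) \<inter> Y = {}"
    and anchor_once: "i < m \<Longrightarrow> at_most_once (map Inl (c i)) (slots D c L m)"
    and dictionary: "i < m \<Longrightarrow> w \<in> words Y L \<Longrightarrow>
      sublist (tl (c i) @ w @ butlast (c (Suc i))) D"
begin

lemma sublist_word_dictionary:
  assumes "w \<in> words Y L"
  shows "sublist w D"
  using sublist_appendI dictionary[OF m_pos assms] by (rule sublist_order.order.trans)

lemma anchor_free_sublist_beginning:
  assumes f: "f \<in> holes (slots D c L m) \<rightarrow> Y"
    and "sublist s (fill (slots D c L m) f)" and free: "\<And>i. i < m \<Longrightarrow> \<not> sublist (c i) s"
  shows "sublist s (D @ butlast (c 0))"
proof -
  define pre where "pre k = D @ concat (map (\<lambda>i. c i @ slot_word f L i) [0..<k])" for k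
  have "sublist s (D @ butlast (c 0))" if "sublist s (pre k @ butlast (c k))" "k \<le> m" for k
    using that
  proof (induction k)
    case 0
    then show ?case by (simp add: pre_def)
  next
    case (Suc k)
    have "sublist s (pre k @ c k @ slot_word f L k @ butlast (c (Suc k)))"
      using Suc.prems(1) by (simp add: pre_def)
    then consider (before) "sublist s (pre k @ butlast (c k))"
      | (around) "sublist s (tl (c k) @ slot_word f L k @ butlast (c (Suc k)))"
      using sublist_append_avoiding free anchor_nonempty Suc.prems(2) by (metis Suc_le_lessD)
    then show ?case
    proof cases
      case before
      then show ?thesis using Suc by simp
    next
      case around
      also have "sublist (tl (c k) @ slot_word f L k @ butlast (c (Suc k))) D"
        using Suc.prems(2) slot_word_in_words[OF f] by (intro dictionary) auto
      also have "sublist D (D @ butlast (c 0))" by simp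
      finally show ?thesis .
    qed
  qed
  moreover have "sublist s (pre m @ butlast (c m))"
    using assms(2) sublist_append_rightI sublist_order.order.trans
    unfolding fill_slots pre_def by blast
  ultimately show ?thesis by blast
qed

lemma sublist_beginning_fill: "sublist (D @ butlast (c 0)) (fill (slots D c L m) f)"
proof -
  have "fill (slots D c L m) f =
      D @ c 0 @ slot_word f L 0 @ concat (map (\<lambda>i. c i @ slot_word f L i) [1..<m])"
    using m_pos by (simp add: fill_slots upt_conv_Cons)
  moreover have "c 0 = butlast (c 0) @ [last (c 0)]" using anchor_nonempty[OF m_pos] by simp
  ultimately show ?thesis by (metis append_assoc sublist_append_rightI)
qed

lemma conjunctive_on_query:
  "conjunctive_on (holes (slots D c L m)) Y (\<lambda>f. sublist s (fill (slots D c L m) f))"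
proof (cases "\<exists>i<m. sublist (c i) s")
  case True
  then obtain i where "i < m" "sublist (c i) s" by blast
  then show ?thesis
    using anchor_once[of i] anchor_disjoint[of i] L_pos m_pos
    by (intro conjunctive_on_sublist_fill[where u = "c i"]) (auto simp: holes_slots)
next
  case False
  then have "sublist s (fill (slots D c L m) f) \<longleftrightarrow> sublist s (D @ butlast (c 0))"
    if "f \<in> holes (slots D c L m) \<rightarrow> Y" for f
    using anchor_free_sublist_beginning[OF that] sublist_beginning_fill sublist_order.order.trans
    by blast
  then show ?thesis using L_pos m_pos by (intro conjunctive_on_const) (auto simp: holes_slots)
qed

lemma num_queries_ge:
  assumes "reconstructs T (fill (slots D c L m) ` (holes (slots D c L m) \<rightarrow> Y))"
  shows "\<exists>f\<in>holes (slots D c L m) \<rightarrow> Y.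
    m * L * (card Y - 1) \<le> num_queries T (fill (slots D c L m) f)"
proof -
  let ?t = "slots D c L m"
  have "\<exists>f\<in>holes ?t \<rightarrow> Y. (\<Sum>k\<in>holes ?t. card Y - 1) \<le> num_queries T (fill ?t f)"
    by (rule adversary_num_queries[OF _ finite_Y _ conjunctive_on_query _ assms])
      (use Y_nonempty in \<open>auto simp: holes_slots fill_eq_iff\<close>)
  then show ?thesis by (simp add: holes_slots)
qed

lemma obtain_hard_filling:
  assumes "reconstructs T (words A n)" "length (slots D c L m) = n"
    and A: "set D \<union> (\<Union>i<m. set (c i)) \<union> Y \<subseteq> A"
    and "lz_parsing D k" "\<And>i. i < m \<Longrightarrow> lz_append D (c i) t"
  obtains S where "S \<in> words A n" "m * L * (card Y - 1) \<le> num_queries T S"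
    "z_no S \<le> k + m * (t + 1)"
proof -
  let ?t = "slots D c L m"
  have in_words: "fill ?t f \<in> words A n" if "f \<in> holes ?t \<rightarrow> Y" for f
    using that assms(2) A by (rule fill_slots_in_words)
  then have "reconstructs T (fill ?t ` (holes ?t \<rightarrow> Y))"
    using assms(1) by (intro reconstructs_subset[OF _ image_subsetI])
  then obtain f
    where f: "f \<in> holes ?t \<rightarrow> Y" "m * L * (card Y - 1) \<le> num_queries T (fill ?t f)"
    using num_queries_ge by blast
  have "z_no (fill ?t f) \<le> k + m * (t + 1)"
    using assms(4,5) sublist_word_dictionary f(1) by (rule z_no_fill_slots_le)
  with in_words[OF f(1)] f(2) show thesis by (rule that)
qed

end

subsection \<open>Runs of zeros as anchors\<close>

definition delimit :: "'a \<Rightarrow> 'a list list \<Rightarrow> 'a list" where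
  "delimit x us = concat (map (Cons x) us)"

lemma delimit_simps [simp]:
  "delimit x [] = []"
  "delimit x (u # us) = x # u @ delimit x us"
  "delimit x (us @ vs) = delimit x us @ delimit x vs"
  by (simp_all add: delimit_def)

lemma delimit_concat_map: "delimit x (concat (map g ys)) = concat (map (\<lambda>y. delimit x (g y)) ys)"
  by (induction ys) simp_all

lemma map_delimit: "map h (delimit x us) = delimit (h x) (map (map h) us)"
  by (induction us) simp_all

lemma delimit_eq_append_ConsD:
  assumes "delimit x us = A @ x # B" "\<And>u. u \<in> set us \<Longrightarrow> x \<notin> set u"
  obtains us1 us2 where "us = us1 @ us2" "delimit x us1 = A" "delimit x us2 = x # B"
proof -
  have "\<exists>us1 us2. us = us1 @ us2 \<and> delimit x us1 = A \<and> delimit x us2 = x # B"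
    using assms
  proof (induction us arbitrary: A)
    case (Cons u us)
    show ?case
    proof (cases A)
      case Nil
      then show ?thesis using Cons.prems(1) by (intro exI[of _ "[]"] exI[of _ "u # us"]) simp
    next
      case (Cons a A')
      then have "a = x" "u @ delimit x us = A' @ x # B" using Cons.prems(1) by auto
      moreover from this(2) obtain V where "A' = u @ V" "delimit x us = V @ x # B"
        using Cons.prems(2)[of u] by (auto simp: append_eq_append_conv2 append_eq_Cons_conv)
      moreover from this(2) obtain us1 us2
        where "us = us1 @ us2" "delimit x us1 = V" "delimit x us2 = x # B"
        using Cons.IH[of V] Cons.prems(2) by auto
      ultimately show ?thesis
        using Cons by (intro exI[of _ "u # us1"] exI[of _ us2]) simp
    qed
  qed simp
  then show thesis using that by blast
qed

lemma delimit_eq_append_segmentD: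
  assumes "delimit x us = X @ (x # v @ [x]) @ Z" "x \<notin> set v"
    and no_delimiter: "\<And>u. u \<in> set us \<Longrightarrow> x \<notin> set u"
  obtains us1 us2 where "us = us1 @ [v] @ us2" "delimit x us1 = X"
proof -
  have "delimit x us = X @ x # v @ x # Z" using assms(1) by simp
  then obtain us1 us2
    where us: "us = us1 @ us2" "delimit x us1 = X" "delimit x us2 = x # v @ x # Z"
    using no_delimiter by (rule delimit_eq_append_ConsD)
  have "delimit x us2 = (x # v) @ x # Z" using us(3) by simp
  then obtain vs us3 where us2: "us2 = vs @ us3" "delimit x vs = x # v"
    by (rule delimit_eq_append_ConsD) (use no_delimiter us(1) in auto)
  have "vs = [v]"
  proof (cases vs)
    case (Cons w ws)
    then show ?thesis using us2(2) assms(2) by (cases ws) auto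
  qed (use us2 in simp)
  then show thesis using that us(1,2) us2(1) by simp
qed

lemma at_most_once_delimit:
  assumes once: "at_most_once [v] us" and x: "x \<notin> set v" "\<And>u. u \<in> set us \<Longrightarrow> x \<notin> set u"
  shows "at_most_once (x # v @ [x]) (delimit x us)"
  unfolding at_most_once_def
proof (intro allI impI)
  fix X Z X' Z'
  assume eq: "delimit x us = X @ (x # v @ [x]) @ Z" "delimit x us = X' @ (x # v @ [x]) @ Z'"
  obtain us1 us2 where us: "us = us1 @ [v] @ us2" "delimit x us1 = X"
    using delimit_eq_append_segmentD[OF eq(1) x] .
  obtain us1' us2' where us': "us = us1' @ [v] @ us2'" "delimit x us1' = X'"
    using delimit_eq_append_segmentD[OF eq(2) x] .
  have "us1 = us1'" using once us(1) us'(1) unfolding at_most_once_def by blast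
  then show "X = X'" using us(2) us'(2) by simp
qed

definition run_anchor :: "nat \<Rightarrow> nat list" where
  "run_anchor i = 1 # replicate (Suc i) 0 @ [1]"

text \<open>The runs around \<open>w\<close> are longer than those of all anchors, so that one block serves for every
  slot that \<open>w\<close> can fill.\<close>

definition run_block :: "nat \<Rightarrow> nat list \<Rightarrow> nat list" where
  "run_block M w = (1 # replicate M 0) @ (1 # w @ [1]) @ replicate M 0"

definition run_dict :: "nat \<Rightarrow> nat \<Rightarrow> nat list list \<Rightarrow> nat list" where
  "run_dict R M ws = (1 # replicate R 0) @ concat (map (run_block M) ws)"

definition run_segments :: "nat \<Rightarrow> nat \<Rightarrow> nat list list \<Rightarrow> nat list list" where
  "run_segments R M ws =
     replicate R 0 # concat (map (\<lambda>w. [replicate M 0, w, replicate M 0]) ws)"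

lemma run_dict_eq_delimit: "run_dict R M ws = delimit 1 (run_segments R M ws)"
proof -
  have "run_block M = (\<lambda>w. delimit 1 [replicate M 0, w, replicate M 0])"
    by (simp add: fun_eq_iff run_block_def)
  then show ?thesis by (simp add: run_dict_def run_segments_def delimit_concat_map)
qed

lemma length_run_anchor: "length (run_anchor i) = i + 3"
  by (simp add: run_anchor_def)

lemma length_run_dict:
  assumes "set ws \<subseteq> words Y L"
  shows "length (run_dict R M ws) = 1 + R + length ws * (2 * M + L + 3)"
  using assms by (induction ws) (auto simp: run_dict_def run_block_def words_def)

lemma set_run_dict_subset: "set ws \<subseteq> words Y L \<Longrightarrow> set (run_dict R M ws) \<subseteq> {0, 1} \<union> Y"
  by (auto simp: run_dict_def run_block_def words_def split: if_splits)

lemma slots_run_eq_delimit: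
  "slots (run_dict R M ws) run_anchor L m =
     delimit (Inl 1) (map (map Inl) (run_segments R M ws) @
       concat (map (\<lambda>i. map Inl (replicate (Suc i) 0) # [map (\<lambda>j. Inr (i, j)) [0..<L]]) [0..<m]))"
  by (simp add: slots_def run_dict_eq_delimit map_delimit delimit_concat_map run_anchor_def)

lemma at_most_once_run_anchor:
  assumes ws: "set ws \<subseteq> words Y L" and Y: "Y \<inter> {0, 1} = {}"
    and "m < M" "m < R" "0 < L" "i < m"
  shows "at_most_once (map Inl (run_anchor i)) (slots (run_dict R M ws) run_anchor L m)"
proof -
  define us where "us = map (map Inl) (run_segments R M ws) @
    concat (map (\<lambda>i. map Inl (replicate (Suc i) 0) # [map (\<lambda>j. Inr (i, j)) [0..<L]]) [0..<m])"
  have not_in: "0 \<notin> set w" "1 \<notin> set w" if "w \<in> set ws" for w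
    using that ws Y by (auto simp: words_def)
  have "at_most_once [map Inl (replicate (Suc i) 0)] us"
    unfolding us_def
  proof (rule at_most_once_concat_map)
    show "inj_on (\<lambda>i. map Inl (replicate (Suc i) 0)) (set [0..<m])"
      by (auto simp: inj_on_def map_replicate simp del: replicate_Suc)
    have "replicate (Suc i) 0 \<notin> set (run_segments R M ws)"
      using assms(3-) not_in(1)[of "replicate (Suc i) 0"]
      by (auto simp: run_segments_def simp del: replicate_Suc)
    then show "map Inl (replicate (Suc i) 0) \<notin> set (map (map Inl) (run_segments R M ws))"
      by (simp add: inj_image_mem_iff inj_mapI del: replicate_Suc map_replicate)
    show "map Inl (replicate (Suc i) 0) \<notin> set [map (\<lambda>j. Inr (i', j)) [0..<L]]" for i'
      using \<open>0 < L\<close> by (auto simp: upt_conv_Cons)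
  qed (use \<open>i < m\<close> in auto)
  moreover have "Inl 1 \<notin> set u" if "u \<in> set us" for u
    using that not_in(2) by (auto simp: us_def run_segments_def split: if_splits)
  ultimately have
    "at_most_once (Inl 1 # map Inl (replicate (Suc i) 0) @ [Inl 1]) (delimit (Inl 1) us)"
    by (intro at_most_once_delimit) auto
  then show ?thesis by (simp add: us_def slots_run_eq_delimit run_anchor_def)
qed

lemma sublist_run_block:
  assumes "i + 2 \<le> M"
  shows "sublist (tl (run_anchor i) @ w @ butlast (run_anchor (Suc i))) (run_block M w)"
proof -
  have M: "replicate M (0::nat) = replicate (M - Suc i) 0 @ replicate (Suc i) 0"
    "replicate M (0::nat) = replicate (Suc (Suc i)) 0 @ replicate (M - Suc (Suc i)) 0"
    using assms by (simp_all flip: replicate_add del: replicate_Suc)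
  have "tl (run_anchor i) @ w @ butlast (run_anchor (Suc i)) =
      replicate (Suc i) 0 @ (1 # w @ [1]) @ replicate (Suc (Suc i)) 0"
    by (simp add: run_anchor_def butlast_append del: replicate_Suc)
  moreover have "run_block M w = (1 # replicate (M - Suc i) 0) @
      (replicate (Suc i) 0 @ (1 # w @ [1]) @ replicate (Suc (Suc i)) 0) @
      replicate (M - Suc (Suc i)) 0"
    unfolding run_block_def by (subst M(1), subst M(2)) simp
  ultimately show ?thesis by (simp only: sublist_appendI)
qed

lemma anchored_slots_run:
  assumes ws: "set ws = words Y L" and Y: "finite Y" "Y \<noteq> {}" "Y \<inter> {0, 1} = {}"
    and "m < M" "m < R" "0 < L" "0 < m"
  shows "anchored_slots (run_dict R M ws) run_anchor L m Y"
proof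
  show "set (run_anchor i) \<inter> Y = {}" for i using Y(3) by (auto simp: run_anchor_def)
  show "at_most_once (map Inl (run_anchor i)) (slots (run_dict R M ws) run_anchor L m)"
    if "i < m" for i
    using assms that by (intro at_most_once_run_anchor) auto
  show "sublist (tl (run_anchor i) @ w @ butlast (run_anchor (Suc i))) (run_dict R M ws)"
    if "i < m" "w \<in> words Y L" for i w
  proof -
    have "sublist (tl (run_anchor i) @ w @ butlast (run_anchor (Suc i))) (run_block M w)"
      using that(1) \<open>m < M\<close> by (intro sublist_run_block) simp
    also have "sublist \<dots> (concat (map (run_block M) ws))"
      using that(2) ws by (intro sublist_concat_map) simp
    also have "sublist \<dots> (run_dict R M ws)"
      unfolding run_dict_def by (rule sublist_append_leftI)
    finally show ?thesis .
  qed
qed (use assms in \<open>auto simp: run_anchor_def\<close>)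

lemma lz_parsing_run_dict:
  assumes "R \<le> 2 ^ k" "M \<le> R" "set ws \<subseteq> words Y L"
  shows "lz_parsing (run_dict R M ws) (k + 2 + length ws * (L + 5))"
proof -
  let ?P = "1 # replicate R (0::nat)"
  have "lz_append [] ([1] @ replicate R (0::nat)) (length [1::nat] + Suc k)"
    using assms(1) by (intro lz_append_append lz_append_letters lz_append_replicate)
  then have "lz_parsing ?P (k + 2)" using lz_parsing_if_append_Nil by simp
  moreover have "lz_append ?P (run_block M w) (L + 5)"
    if "w \<in> set ws" for w
  proof -
    have "sublist (replicate M 0) ?P"
      using sublist_replicate[OF assms(2), of "0::nat"] by (simp add: sublist_Cons_right)
    then have run: "lz_append ?P (replicate M 0) 1" by (rule lz_append_sublist)
    have "lz_append ?P ([1] @ replicate M 0 @ (1 # w @ [1]) @ replicate M 0)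
        (length [1::nat] + (1 + (length (1 # w @ [1]) + 1)))"
      by (intro lz_append_append lz_append_letters run)
    moreover have "length w = L" using that assms(3) by (auto simp: words_def)
    ultimately show ?thesis by (simp add: run_block_def eval_nat_numeral)
  qed
  ultimately show ?thesis
    unfolding run_dict_def by (intro lz_parsing_append lz_append_concat_map)
qed

lemma lz_append_run_anchor:
  assumes "i < R"
  shows "lz_append (run_dict R M ws) (run_anchor i) 3"
proof -
  let ?D = "run_dict R M ws"
  have "sublist (replicate (Suc i) 0) (replicate R (0::nat))"
    using assms by (intro sublist_replicate) simp
  also have "sublist (replicate R 0) ([1] @ replicate R 0 @ concat (map (run_block M) ws))"
    by (rule sublist_appendI)
  also have "\<dots> = ?D" by (simp add: run_dict_def)
  finally have "lz_append ?D ([1] @ replicate (Suc i) 0 @ [1])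
      (length [1::nat] + (1 + length [1::nat]))"
    by (intro lz_append_append lz_append_letters lz_append_sublist)
  then show ?thesis by (simp add: run_anchor_def eval_nat_numeral)
qed

lemma run_overhead_le:
  fixes q L m :: nat
  assumes "q \<le> m" "L \<le> m" "2 \<le> m"
  shows "1 + q * (2 * (m + 1) + L + 3) + (\<Sum>i<m. i + 3 + L) + (m + 1) \<le> 10 * (m * m)"
proof -
  have "q * (2 * (m + 1) + L + 3) \<le> m * (3 * m + 5)" using assms by (intro mult_mono) auto
  moreover have "(\<Sum>i<m. i + 3 + L) \<le> (\<Sum>i<m. 2 * m + 2)" using assms by (intro sum_mono) auto
  moreover have "m * (3 * m + 5) = 3 * (m * m) + 5 * m" "(\<Sum>i<m. 2 * m + 2) = 2 * (m * m) + 2 * m"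
    by (simp_all add: algebra_simps)
  moreover have "2 * m \<le> m * m" "2 * 2 \<le> m * m"
    using mult_le_mono1[OF assms(3)] mult_le_mono[OF assms(3) assms(3)] by simp_all
  ultimately show ?thesis by linarith
qed

lemma obtain_hard_string_run_anchors:
  fixes \<sigma> L n k :: nat
  defines "m \<equiv> L * (\<sigma> - 2) ^ L"
  assumes \<sigma>: "4 \<le> \<sigma>" and L: "0 < L" and n: "10 * (m * m) \<le> n" "n \<le> 2 ^ k"
    and T: "reconstructs T (words {..<\<sigma>} n)"
  obtains S where "S \<in> words {..<\<sigma>} n" "m * L * (\<sigma> - 3) \<le> num_queries T S"
    "z_no S \<le> k + 10 * m + 2"
proof -
  define q where "q = (\<sigma> - 2) ^ L"
  define ws where "ws = List.n_lists L [2..<\<sigma>]"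
  have ws: "set ws = words {2..<\<sigma>} L" "length ws = q"
    by (simp_all add: ws_def set_n_lists_eq_words length_n_lists q_def)
  have m: "m = L * q" by (simp add: m_def q_def)
  have "2 ^ 1 \<le> (2::nat) ^ L" using L by (intro power_increasing) auto
  also have "\<dots> \<le> q" unfolding q_def using \<sigma> by (intro power_mono) auto
  finally have q: "2 \<le> q" by simp
  then have le_m: "q \<le> m" "L \<le> m" "2 \<le> m" using L by (auto simp: m intro: order.trans[of 2 q])
  define overhead where "overhead = 1 + q * (2 * (m + 1) + L + 3) + (\<Sum>i<m. i + 3 + L)"
  define R where "R = n - overhead"
  have R: "overhead + R = n" "m < R"
    using run_overhead_le[OF le_m] n(1) by (auto simp: R_def overhead_def)
  let ?D = "run_dict R (m + 1) ws"
  interpret anchored_slots ?D run_anchor L m "{2..<\<sigma>}"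
    using anchored_slots_run[OF ws(1) _ _ _ _ R(2) L] \<sigma> le_m(3) by simp
  show thesis
  proof (rule obtain_hard_filling[OF T])
    show "length (slots ?D run_anchor L m) = n"
      using R(1) ws length_run_dict[of ws "{2..<\<sigma>}" L]
      by (simp add: length_slots length_run_anchor overhead_def)
    show "lz_parsing ?D (k + 2 + length ws * (L + 5))"
      using R n(2) ws by (intro lz_parsing_run_dict) auto
    show "lz_append ?D (run_anchor i) 3" if "i < m" for i
      using R(2) that by (intro lz_append_run_anchor) simp
    show "set ?D \<union> (\<Union>i<m. set (run_anchor i)) \<union> {2..<\<sigma>} \<subseteq> {..<\<sigma>}"
      using set_run_dict_subset[of ws "{2..<\<sigma>}" L R "m + 1"] ws(1) \<sigma>
      by (auto simp: run_anchor_def)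
    fix S
    assume "S \<in> words {..<\<sigma>} n" "m * L * (card {2..<\<sigma>} - 1) \<le> num_queries T S"
      "z_no S \<le> k + 2 + length ws * (L + 5) + m * (3 + 1)"
    moreover have "length ws * (L + 5) = m + 5 * q" by (simp add: ws(2) m algebra_simps)
    ultimately show thesis using that[of S] le_m(1) by simp
  qed
qed

subsection \<open>Letters as anchors\<close>

lemma anchored_slots_letter:
  assumes "0 < h"
  shows "anchored_slots (replicate R 0 @ [1..<Suc h]) (\<lambda>i. [Suc h + i]) 1 h {1..h}"
proof
  let ?D = "replicate R 0 @ [1..<Suc h]"
  show "at_most_once (map Inl [Suc h + i]) (slots ?D (\<lambda>i. [Suc h + i]) 1 h)" if "i < h" for i
  proof -
    have "at_most_once [Inl (Suc h + i)]
      (map Inl ?D @ concat (map (\<lambda>i. Inl (Suc h + i) # [Inr (i, 0)]) [0..<h]))"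
      using that by (intro at_most_once_concat_map) (auto simp: inj_on_def)
    then show ?thesis by (simp add: slots_def)
  qed
  show "sublist (tl [Suc h + i] @ w @ butlast [Suc h + Suc i]) ?D"
    if word: "w \<in> words {1..h} 1" for w i
  proof -
    obtain a where w: "w = [a]" using word by (auto simp: words_def length_Suc_conv)
    then have "a \<in> set ?D" using word by (auto simp: words_def)
    then show ?thesis using sublist_concat_map[of a ?D "\<lambda>a. [a]"] by (simp add: w)
  qed
qed (use assms in auto)

lemma obtain_hard_string_letter_anchors:
  fixes h n k :: nat
  assumes h: "0 < h" "3 * h \<le> n" and n: "n \<le> 2 ^ k" and T: "reconstructs T (words {..2 * h} n)"
  obtains S where "S \<in> words {..2 * h} n" "h * (h - 1) \<le> num_queries T S" "z_no S \<le> k + 3 * h + 1"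
proof -
  define R where "R = n - 3 * h"
  let ?D = "replicate R 0 @ [1..<Suc h]" and ?c = "\<lambda>i. [Suc h + i]"
  interpret anchored_slots ?D ?c 1 h "{1..h}" using h(1) by (rule anchored_slots_letter)
  show thesis
  proof (rule obtain_hard_filling[OF T])
    show "length (slots ?D ?c 1 h) = n" using h by (simp add: length_slots R_def)
    show "set ?D \<union> (\<Union>i<h. set (?c i)) \<union> {1..h} \<subseteq> {..2 * h}" by auto
    have "R \<le> 2 ^ k" using n by (simp add: R_def)
    then have "lz_append [] ?D (Suc k + length [1..<Suc h])"
      by (intro lz_append_append lz_append_replicate lz_append_letters)
    then show "lz_parsing ?D (Suc k + h)"
      using lz_parsing_if_append_Nil by (simp del: upt_Suc)
    show "lz_append ?D (?c i) 1" for i using lz_append_letters[of ?D "?c i"] by simp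
  qed (use that in simp)
qed

subsection \<open>Slots without anchors\<close>

lemma obtain_hard_string_counting:
  fixes b L n k :: nat
  defines "m \<equiv> L * b ^ L"
  assumes b: "2 \<le> b" and n: "m + m * L \<le> n" "n \<le> 2 ^ k" and T: "reconstructs T (words {..<b} n)"
  obtains S where "S \<in> words {..<b} n" "m * L \<le> num_queries T S" "z_no S \<le> k + 2 * m + 1"
proof -
  define R where "R = n - (m + m * L)"
  define ws where "ws = List.n_lists L [0..<b]"
  define D where "D = replicate R 0 @ concat ws"
  let ?t = "slots D (\<lambda>_. []) L m"
  have ws: "set ws = words {..<b} L" by (simp add: ws_def set_n_lists_eq_words atLeast0LessThan)
  have len_ws: "length (concat ws) = m" by (simp add: ws_def length_concat_n_lists m_def)
  have len: "length ?t = n" using n(1) len_ws by (simp add: length_slots D_def R_def)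
  have in_words: "fill ?t f \<in> words {..<b} n" if "f \<in> holes ?t \<rightarrow> {..<b}" for f
    using that len by (rule fill_slots_in_words) (use ws b in \<open>auto simp: D_def words_def\<close>)
  have "\<exists>f\<in>holes ?t \<rightarrow> {..<b}. card (holes ?t) \<le> num_queries T (fill ?t f)"
  proof (rule counting_num_queries)
    show "reconstructs T (fill ?t ` (holes ?t \<rightarrow> {..<b}))"
      using T in_words by (intro reconstructs_subset[OF _ image_subsetI])
  qed (use b in \<open>auto simp: fill_eq_iff holes_slots\<close>)
  then obtain f where f: "f \<in> holes ?t \<rightarrow> {..<b}" "m * L \<le> num_queries T (fill ?t f)"
    by (auto simp: holes_slots)
  have "R \<le> 2 ^ k" using n by (simp add: R_def)
  then have "lz_append [] D (Suc k + m)"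
    unfolding D_def len_ws[symmetric]
    by (intro lz_append_append lz_append_replicate lz_append_letters)
  then have "lz_parsing D (Suc k + m)" by (rule lz_parsing_if_append_Nil)
  moreover have "lz_append D [] 0" using lz_append_letters[of D "[]"] by simp
  moreover have "sublist w D" if "w \<in> words {..<b} L" for w
  proof -
    have "sublist w (concat ws)" using sublist_concat_map[of w ws "\<lambda>w. w"] that by (simp add: ws)
    also have "sublist \<dots> D" by (simp add: D_def)
    finally show ?thesis .
  qed
  ultimately have "z_no (fill ?t f) \<le> Suc k + m + m * (0 + 1)"
    using f(1) by (intro z_no_fill_slots_le)
  then show thesis using that[OF in_words[OF f(1)] f(2)] by simp
qed

subsection \<open>Choice of parameters\<close>

lemma le_two_power_mult:
  fixes b n p :: nat
  assumes "n \<le> b ^ p"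
  shows "n \<le> 2 ^ (b * p)"
proof -
  have "b ^ p \<le> (2 ^ b) ^ p" by (intro power_mono) (auto intro: less_imp_le)
  then show ?thesis using assms by (simp add: power_mult)
qed

lemma hard_string_tiny_alphabet:
  fixes \<sigma> n :: nat
  assumes \<sigma>: "2 \<le> \<sigma>" "\<sigma> \<le> 3" and n: "16 \<le> n" and T: "reconstructs T (words {..<\<sigma>} n)"
  obtains S p where "S \<in> words {..<\<sigma>} n" "n \<le> \<sigma> ^ p"
    "\<sigma> * z_no S * p \<le> 2000 * num_queries T S"
proof -
  obtain L where L: "16 ^ L \<le> n" "n < 16 ^ (L + 1)"
    using ex_power_ivl1[of 16 n] n by auto
  have L_pos: "0 < L" using L n by (cases L) auto
  define m where "m = L * 2 ^ L"
  have "L < 2 ^ L" by (rule less_exp)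
  then have "L * 2 ^ L * (L + 1) \<le> 2 ^ L * 2 ^ L * 2 ^ L"
    by (intro mult_mono) (simp_all add: Suc_le_eq)
  also have "\<dots> = (8::nat) ^ L" by (simp flip: power_mult_distrib)
  also have "\<dots> \<le> 16 ^ L" by (rule power_mono) auto
  finally have len: "m + m * L \<le> n" using L(1) by (simp add: m_def algebra_simps)
  have "(16::nat) ^ (L + 1) \<le> 16 ^ (2 * L)" using L_pos by (intro power_increasing) auto
  also have "\<dots> = (2 ^ 4) ^ (2 * L)" by simp
  also have "\<dots> = 2 ^ (8 * L)" by (simp only: power_mult[symmetric]) simp
  finally have n_le: "n \<le> 2 ^ (8 * L)" using L(2) by simp
  have sub: "words {..<2} n \<subseteq> words {..<\<sigma>} n" using \<sigma>(1) by (intro words_mono) simp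
  obtain S where S: "S \<in> words {..<2} n" "m * L \<le> num_queries T S" "z_no S \<le> 8 * L + 2 * m + 1"
    using obtain_hard_string_counting[OF order_refl len[unfolded m_def] n_le]
      reconstructs_subset[OF T sub]
    unfolding m_def by blast
  have "2 ^ 1 \<le> (2::nat) ^ L" using L_pos by (intro power_increasing) auto
  then have "L * 2 \<le> m" unfolding m_def by (intro mult_left_mono) auto
  then have "z_no S \<le> 7 * m" using S(3) L_pos by linarith
  then have "\<sigma> * z_no S * (8 * L) \<le> 3 * (7 * m) * (8 * L)" using \<sigma> by (intro mult_mono) auto
  also have "\<dots> = 168 * (m * L)" by simp
  also have "\<dots> \<le> 2000 * num_queries T S" using S(2) by linarith
  finally have "\<sigma> * z_no S * (8 * L) \<le> 2000 * num_queries T S" .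
  moreover have "n \<le> \<sigma> ^ (8 * L)"
    using n_le power_mono[OF \<sigma>(1), of "8 * L"] by simp
  ultimately show thesis using that S(1) sub by blast
qed

lemma ten_mult_square_le_power:
  fixes \<sigma> L :: nat
  defines "m \<equiv> L * (\<sigma> - 2) ^ L"
  assumes \<sigma>: "4 \<le> \<sigma>" and L: "0 < L"
  shows "10 * (m * m) \<le> (\<sigma> ^ 5) ^ L"
proof -
  have "m \<le> 2 ^ L * \<sigma> ^ L"
    unfolding m_def by (intro mult_mono power_mono less_imp_le[OF less_exp]) auto
  then have "m * m \<le> (2 ^ L * \<sigma> ^ L) * (2 ^ L * \<sigma> ^ L)" by (intro mult_mono) auto
  also have "\<dots> = (2 * 2) ^ L * (\<sigma> ^ L * \<sigma> ^ L)" by (simp only: power_mult_distrib mult_ac)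
  also have "\<dots> \<le> \<sigma> ^ L * (\<sigma> ^ L * \<sigma> ^ L)" using \<sigma> by (intro mult_mono power_mono) auto
  finally have m_square: "m * m \<le> \<sigma> ^ L * (\<sigma> ^ L * \<sigma> ^ L)" .
  have "(10::nat) \<le> 4 ^ 2" by simp
  also have "\<dots> \<le> \<sigma> ^ 2" using \<sigma> by (intro power_mono) auto
  also have "\<dots> \<le> \<sigma> ^ (2 * L)" using \<sigma> L by (intro power_increasing) auto
  finally have "10 * (m * m) \<le> \<sigma> ^ (2 * L) * (\<sigma> ^ L * (\<sigma> ^ L * \<sigma> ^ L))"
    using m_square by (rule mult_mono) auto
  also have "\<dots> = (\<sigma> ^ 5) ^ L" by (simp flip: power_add power_mult)
  finally show ?thesis .
qed

lemma hard_string_small_alphabet: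
  fixes \<sigma> n :: nat
  assumes \<sigma>: "4 \<le> \<sigma>" and n: "\<sigma> ^ 5 \<le> n" and T: "reconstructs T (words {..<\<sigma>} n)"
  obtains S p where "S \<in> words {..<\<sigma>} n" "n \<le> \<sigma> ^ p"
    "\<sigma> * z_no S * p \<le> 2000 * num_queries T S"
proof -
  have "2 \<le> \<sigma> ^ 5" using \<sigma> self_le_power[of \<sigma> 5] by simp
  then obtain L where L: "(\<sigma> ^ 5) ^ L \<le> n" "n < (\<sigma> ^ 5) ^ (L + 1)"
    using ex_power_ivl1[of "\<sigma> ^ 5" n] n by auto
  have L_pos: "0 < L" using L n by (cases L) auto
  define m where "m = L * (\<sigma> - 2) ^ L"
  have "10 * (m * m) \<le> (\<sigma> ^ 5) ^ L"
    unfolding m_def using \<sigma> L_pos by (rule ten_mult_square_le_power)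
  then have len: "10 * (m * m) \<le> n" using L(1) by simp
  have "(\<sigma> ^ 5) ^ (L + 1) \<le> \<sigma> ^ (10 * L)"
    unfolding power_mult[symmetric] using \<sigma> L_pos by (intro power_increasing) auto
  then have n_le: "n \<le> \<sigma> ^ (10 * L)" using L(2) by simp
  obtain S where S: "S \<in> words {..<\<sigma>} n" "m * L * (\<sigma> - 3) \<le> num_queries T S"
    "z_no S \<le> \<sigma> * (10 * L) + 10 * m + 2"
    using obtain_hard_string_run_anchors[OF \<sigma> L_pos len[unfolded m_def] _ T]
      le_two_power_mult[OF n_le]
    unfolding m_def by blast
  have "(\<sigma> - 2) ^ 1 \<le> (\<sigma> - 2) ^ L" using \<sigma> L_pos by (intro power_increasing) auto
  then have m: "L * (\<sigma> - 2) \<le> m" unfolding m_def by (intro mult_left_mono) auto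
  have "\<sigma> * L \<le> 2 * (\<sigma> - 2) * L" using \<sigma> by (intro mult_le_mono1) simp
  also have "\<dots> = 2 * (L * (\<sigma> - 2))" by simp
  also have "\<dots> \<le> 2 * m" using m by (rule mult_le_mono2)
  finally have "\<sigma> * L \<le> 2 * m" .
  moreover have "1 * 2 \<le> L * (\<sigma> - 2)" using \<sigma> L_pos by (intro mult_mono) auto
  ultimately have "z_no S \<le> 31 * m" using S(3) m by linarith
  then have "\<sigma> * z_no S * (10 * L) \<le> (4 * (\<sigma> - 3)) * (31 * m) * (10 * L)"
    using \<sigma> by (intro mult_mono) auto
  also have "\<dots> = 1240 * (m * L * (\<sigma> - 3))" by simp
  also have "\<dots> \<le> 2000 * num_queries T S" using S(2) by linarith
  finally show thesis using that S(1) n_le by blast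
qed

lemma hard_string_large_alphabet:
  fixes \<sigma> n :: nat
  assumes \<sigma>: "6 \<le> \<sigma>" and n: "\<sigma> \<le> n" "n \<le> \<sigma> ^ 5" and T: "reconstructs T (words {..<\<sigma>} n)"
  obtains S where "S \<in> words {..<\<sigma>} n" "\<sigma> * z_no S * 5 \<le> 2000 * num_queries T S"
proof -
  define h where "h = \<sigma> div 3"
  have h: "2 \<le> h" "3 * h \<le> \<sigma>" "\<sigma> \<le> 4 * h" using \<sigma> by (auto simp: h_def)
  have sub: "words {..2 * h} n \<subseteq> words {..<\<sigma>} n" using h by (intro words_mono) auto
  have "0 < h" "3 * h \<le> n" using h n(1) by auto
  then obtain S where S: "S \<in> words {..2 * h} n" "h * (h - 1) \<le> num_queries T S"
    "z_no S \<le> \<sigma> * 5 + 3 * h + 1"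
    using obtain_hard_string_letter_anchors le_two_power_mult[OF n(2)]
      reconstructs_subset[OF T sub]
    by blast
  have "\<sigma> \<le> 8 * (h - 1)" "z_no S \<le> 24 * h" using S(3) h by linarith+
  then have "\<sigma> * z_no S * 5 \<le> (8 * (h - 1)) * (24 * h) * 5" by (intro mult_mono) auto
  also have "\<dots> \<le> 2000 * (h * (h - 1))" by simp
  also have "\<dots> \<le> 2000 * num_queries T S" using S(2) by simp
  finally show thesis using that S(1) sub by blast
qed

lemma hard_string_exists:
  fixes \<sigma> n :: nat
  assumes "2 \<le> \<sigma>" "\<sigma> \<le> n" "6 ^ 5 \<le> n" and T: "reconstructs T (words {..<\<sigma>} n)"
  obtains S p where "S \<in> words {..<\<sigma>} n" "n \<le> \<sigma> ^ p"
    "\<sigma> * z_no S * p \<le> 2000 * num_queries T S"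
proof -
  consider (tiny) "\<sigma> \<le> 3" | (small) "4 \<le> \<sigma>" "\<sigma> ^ 5 \<le> n" | (large) "n < \<sigma> ^ 5" by linarith
  then show thesis
  proof cases
    case tiny
    then show ?thesis using hard_string_tiny_alphabet[OF assms(1) _ _ T] assms(3) that by auto
  next
    case small
    then show ?thesis using hard_string_small_alphabet[OF _ _ T] that by blast
  next
    case large
    then have "6 ^ 5 < \<sigma> ^ 5" using assms(3) by linarith
    then have "6 \<le> \<sigma>" by (meson less_imp_le power_less_imp_less_base zero_le)
    then show ?thesis
      using hard_string_large_alphabet[OF _ assms(2) _ T] large that[of _ 5] less_imp_le by blast
  qed
qed

theorem theorem3:
  shows "\<exists>c::real. c > 0 \<and> (\<exists>N::nat. \<forall>(\<sigma>::nat) (n::nat) (T::qtree).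
     2 \<le> \<sigma> \<longrightarrow> \<sigma> \<le> n \<longrightarrow> N \<le> n \<longrightarrow>
     (\<forall>S. length S = n \<and> set S \<subseteq> {..<\<sigma>} \<longrightarrow> run T S = S) \<longrightarrow>
     (\<exists>S. length S = n \<and> set S \<subseteq> {..<\<sigma>} \<and>
          real (num_queries T S) \<ge> c * real \<sigma> * real (z_no S) * log (real \<sigma>) (real n)))"
proof (intro exI[of _ "1 / 2000 :: real"] conjI exI[of _ "6 ^ 5 :: nat"] allI impI)
  fix \<sigma> n :: nat and T :: qtree
  assume \<sigma>: "2 \<le> \<sigma>" "\<sigma> \<le> n" and n: "6 ^ 5 \<le> n"
    and "\<forall>S. length S = n \<and> set S \<subseteq> {..<\<sigma>} \<longrightarrow> run T S = S"
  then have "reconstructs T (words {..<\<sigma>} n)" by (simp add: reconstructs_def words_def)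
  with \<sigma> n obtain S p where S: "S \<in> words {..<\<sigma>} n" "n \<le> \<sigma> ^ p"
    and hard: "\<sigma> * z_no S * p \<le> 2000 * num_queries T S"
    by (rule hard_string_exists)
  have "log (real \<sigma>) (real n) \<le> real p"
    using \<sigma> S(2) by (intro log_of_power_le) (auto simp flip: of_nat_power)
  then have "real \<sigma> * real (z_no S) * log (real \<sigma>) (real n) \<le> real \<sigma> * real (z_no S) * real p"
    by (intro mult_left_mono) auto
  also have "\<dots> \<le> 2000 * real (num_queries T S)"
    using of_nat_mono[OF hard, where 'a = real] by simp
  finally show "\<exists>S. length S = n \<and> set S \<subseteq> {..<\<sigma>} \<and>
    1 / 2000 * real \<sigma> * real (z_no S) * log (real \<sigma>) (real n) \<le> real (num_queries T S)"
    using S(1) by (intro exI[of _ S]) (simp add: words_def)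
qed simp

end
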